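(* Let $A,I$ be finite sets, $L\subseteq A^I$, and $X,Y\subseteq I$ with $X\cup Y=I$ such that $X$ and $Y$ decompose $L$. If $K$ is a minimal simplicial complex generating $L$, then every maximal simplex of $K$ that intersects both $X$ and $Y$ intersects $X\cap Y$.
   Context: For finite sets $A,I$, a language is a subset $L\subseteq A^I$. For finite sets $B,J$ and a function $f:B^J\to A^I$, the input window $\mathcal{W}_f(i)\subseteq J$ of $i\in I$ is the smallest $W\subseteq J$ such that for all $x,y\in B^J$ agreeing on $W$, $f(x)_i=f(y)_i$. The communication complex $K_f$ is the simplicial complex on vertex set $I$ whose simplices are the sets $S\subseteq I$ with $\bigcap_{i\in S}\mathcal{W}_f(i)\neq\emptyset$. A simplicial complex $K$ on $I$ generates $L$ if there exist finite sets $B,J$ and $f:B^J\to A^I$ with $f(B^J)=L$ and $K_f\subseteq K$; $K$ is minimal generating $L$ if it generates $L$ and no complex properly contained in $K$ generates $L$. Sets $X,Y\subseteq I$ with $X\cup Y=I$ decompose $L$ if for every $w\in A^I$ such that both restrictions $w|_X$ and $w|_Y$ have extensions in $L$, one has $w\in L$. *)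

theory Defs
  imports "HOL-Library.FuncSet"
begin

text \<open>Elements of \<open>A^I\<close> are the extensional functions \<open>I \<rightarrow>\<^sub>E A\<close>.\<close>

definition determines :: "'j set \<Rightarrow> 'b set \<Rightarrow> (('j \<Rightarrow> 'b) \<Rightarrow> 'i \<Rightarrow> 'a) \<Rightarrow> 'i \<Rightarrow> 'j set \<Rightarrow> bool" where
  "determines J B f i W \<longleftrightarrow> W \<subseteq> J \<and>
     (\<forall>x \<in> J \<rightarrow>\<^sub>E B. \<forall>y \<in> J \<rightarrow>\<^sub>E B. (\<forall>j\<in>W. x j = y j) \<longrightarrow> f x i = f y i)"

text \<open>The least set is taken with respect to inclusion; \<open>is_least_input_window\<close> below shows
  that it exists when \<open>J\<close> is finite.\<close>

definition input_window :: "'j set \<Rightarrow> 'b set \<Rightarrow> (('j \<Rightarrow> 'b) \<Rightarrow> 'i \<Rightarrow> 'a) \<Rightarrow> 'i \<Rightarrow> 'j set" where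
  "input_window J B f i = (LEAST W. determines J B f i W)"

text \<open>Singletons are not required to be simplices: if the \<open>i\<close>-th output of \<open>f\<close> is constant then
  \<open>{i}\<close> is not a simplex of the communication complex. The empty set is treated like any other
  subset of \<open>I\<close>.\<close>

definition simplicial_complex_on :: "'i set \<Rightarrow> 'i set set \<Rightarrow> bool" where
  "simplicial_complex_on I K \<longleftrightarrow> K \<subseteq> Pow I \<and> (\<forall>S\<in>K. \<forall>T\<subseteq>S. T \<in> K)"

text \<open>Windows are subsets of \<open>J\<close>, so their intersection is taken inside \<open>J\<close>; this only
  matters for \<open>S = {}\<close>.\<close>

definition communication_complex ::
    "'i set \<Rightarrow> 'j set \<Rightarrow> 'b set \<Rightarrow> (('j \<Rightarrow> 'b) \<Rightarrow> 'i \<Rightarrow> 'a) \<Rightarrow> 'i set set" where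
  "communication_complex I J B f =
     {S. S \<subseteq> I \<and> J \<inter> (\<Inter>i\<in>S. input_window J B f i) \<noteq> {}}"

text \<open>The finite sets \<open>B\<close> and \<open>J\<close> range over sets of natural numbers, since types cannot be
  quantified over; \<open>generatesI\<close> below shows that this loses no generality.\<close>

definition generates :: "'a set \<Rightarrow> 'i set \<Rightarrow> 'i set set \<Rightarrow> ('i \<Rightarrow> 'a) set \<Rightarrow> bool" where
  "generates A I K L \<longleftrightarrow>
     (\<exists>(B :: nat set) (J :: nat set) f. finite B \<and> finite J \<and>
        f \<in> (J \<rightarrow>\<^sub>E B) \<rightarrow> (I \<rightarrow>\<^sub>E A) \<and> f ` (J \<rightarrow>\<^sub>E B) = L \<and>
        communication_complex I J B f \<subseteq> K)"

definition minimal_generating :: "'a set \<Rightarrow> 'i set \<Rightarrow> 'i set set \<Rightarrow> ('i \<Rightarrow> 'a) set \<Rightarrow> bool" where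
  "minimal_generating A I K L \<longleftrightarrow>
     simplicial_complex_on I K \<and> generates A I K L \<and>
     (\<forall>K'. simplicial_complex_on I K' \<and> K' \<subset> K \<longrightarrow> \<not> generates A I K' L)"

definition maximal_simplex :: "'i set set \<Rightarrow> 'i set \<Rightarrow> bool" where
  "maximal_simplex K S \<longleftrightarrow> S \<in> K \<and> (\<forall>T\<in>K. S \<subseteq> T \<longrightarrow> T = S)"

definition decompose :: "'a set \<Rightarrow> 'i set \<Rightarrow> 'i set \<Rightarrow> 'i set \<Rightarrow> ('i \<Rightarrow> 'a) set \<Rightarrow> bool" where
  "decompose A I X Y L \<longleftrightarrow>
     (\<forall>w \<in> I \<rightarrow>\<^sub>E A. (\<exists>u\<in>L. restrict u X = restrict w X) \<and> (\<exists>v\<in>L. restrict v Y = restrict w Y)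
        \<longrightarrow> w \<in> L)"

lemma determinesD:
  assumes "determines J B f i W" "x \<in> J \<rightarrow>\<^sub>E B" "y \<in> J \<rightarrow>\<^sub>E B" "\<And>j. j \<in> W \<Longrightarrow> x j = y j"
  shows "f x i = f y i"
  using assms unfolding determines_def by blast

lemma determines_subset: "determines J B f i W \<Longrightarrow> W \<subseteq> J"
  unfolding determines_def by (rule conjunct1)

lemma determines_Int:
  assumes "determines J B f i V" "determines J B f i W"
  shows "determines J B f i (V \<inter> W)"
  unfolding determines_def
proof (intro conjI ballI impI)
  show "V \<inter> W \<subseteq> J" using determines_subset[OF assms(1)] by blast
  fix x y assume x: "x \<in> J \<rightarrow>\<^sub>E B" and y: "y \<in> J \<rightarrow>\<^sub>E B" and xy: "\<forall>j\<in>V \<inter> W. x j = y j"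
  define z where "z = (\<lambda>j. if j \<in> V then x j else y j)"
  have z: "z \<in> J \<rightarrow>\<^sub>E B"
  proof (rule PiE_I)
    show "z j \<in> B" if "j \<in> J" for j
      using PiE_mem[OF x that] PiE_mem[OF y that] by (simp add: z_def)
    show "z j = undefined" if "j \<notin> J" for j
      using PiE_arb[OF x that] PiE_arb[OF y that] by (simp add: z_def)
  qed
  have "f x i = f z i" by (rule determinesD[OF assms(1) x z]) (simp add: z_def)
  also have "f z i = f y i" by (rule determinesD[OF assms(2) z y]) (use xy in \<open>simp add: z_def\<close>)
  finally show "f x i = f y i" .
qed

lemma is_least_input_window:
  assumes "finite J"
  shows "determines J B f i (input_window J B f i)"
    and "determines J B f i W \<Longrightarrow> input_window J B f i \<subseteq> W"
proof -
  have "determines J B f i J"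
    unfolding determines_def by (metis PiE_ext order_refl)
  then obtain V where V: "determines J B f i V"
    and V_min: "\<And>W. determines J B f i W \<Longrightarrow> card V \<le> card W"
    using ex_has_least_nat[of "determines J B f i" J card] by blast
  have "finite V" using determines_subset[OF V] assms by (rule finite_subset)
  have least: "V \<subseteq> W" if "determines J B f i W" for W
    using card_seteq[OF \<open>finite V\<close> Int_lower1 V_min[OF determines_Int[OF V that]]] by blast
  have "input_window J B f i = V"
    unfolding input_window_def by (rule Least_equality) (use V least in auto)
  then show "determines J B f i (input_window J B f i)"
    and "determines J B f i W \<Longrightarrow> input_window J B f i \<subseteq> W"
    using V least by auto
qed

lemma generatesI:
  fixes B :: "'b set" and J :: "'j set" and f :: "('j \<Rightarrow> 'b) \<Rightarrow> 'i \<Rightarrow> 'a"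
  assumes B: "finite B" and J: "finite J" and f: "f \<in> (J \<rightarrow>\<^sub>E B) \<rightarrow> (I \<rightarrow>\<^sub>E A)"
    and L: "f ` (J \<rightarrow>\<^sub>E B) = L" and K: "communication_complex I J B f \<subseteq> K"
  shows "generates A I K L"
proof -
  obtain h :: "'b \<Rightarrow> nat" where h: "inj_on h B" using finite_imp_inj_to_nat_seg[OF B] by blast
  obtain g :: "'j \<Rightarrow> nat" where g: "inj_on g J" using finite_imp_inj_to_nat_seg[OF J] by blast
  define B' J' where "B' = h ` B" and "J' = g ` J"
  define p where "p x = (\<lambda>j\<in>J. inv_into B h (x (g j)))" for x
  define q where "q x = (\<lambda>k\<in>J'. h (x (inv_into J g k)))" for x
  define f' where "f' = (\<lambda>x. f (p x))"
  have p: "p x \<in> J \<rightarrow>\<^sub>E B" if "x \<in> J' \<rightarrow>\<^sub>E B'" for x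
    using that by (auto simp: p_def B'_def J'_def PiE_iff intro!: inv_into_into)
  have q: "q x \<in> J' \<rightarrow>\<^sub>E B'" "p (q x) = x" if "x \<in> J \<rightarrow>\<^sub>E B" for x
  proof -
    show "q x \<in> J' \<rightarrow>\<^sub>E B'"
      using that by (auto simp: q_def B'_def J'_def PiE_iff intro!: imageI inv_into_into)
    show "p (q x) = x"
    proof
      fix j
      show "p (q x) j = x j"
      proof (cases "j \<in> J")
        case True
        then have "q x (g j) = h (x j)" by (simp add: q_def J'_def inv_into_f_f[OF g])
        moreover have "x j \<in> B" using that True by (rule PiE_mem)
        ultimately show ?thesis using True by (simp add: p_def inv_into_f_f[OF h])
      next
        case False
        then show ?thesis using PiE_arb[OF that False] by (simp add: p_def)
      qed
    qed
  qed
  have "p ` (J' \<rightarrow>\<^sub>E B') = J \<rightarrow>\<^sub>E B"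
  proof (intro subset_antisym subsetI)
    fix x assume "x \<in> J \<rightarrow>\<^sub>E B"
    then show "x \<in> p ` (J' \<rightarrow>\<^sub>E B')" using q by (intro image_eqI[where x = "q x"]) simp_all
  qed (use p in blast)
  then have img: "f' ` (J' \<rightarrow>\<^sub>E B') = L" using L unfolding f'_def by (metis image_image)
  have map: "f' \<in> (J' \<rightarrow>\<^sub>E B') \<rightarrow> (I \<rightarrow>\<^sub>E A)" using f p by (auto simp: f'_def)
  have fin: "finite B'" "finite J'" using B J by (auto simp: B'_def J'_def)
  have window: "input_window J' B' f' i \<subseteq> g ` input_window J B f i" for i
  proof (rule is_least_input_window(2)[OF fin(2)])
    have d: "determines J B f i (input_window J B f i)" by (rule is_least_input_window(1)[OF J])
    have det: "f (p x) i = f (p y) i"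
      if "x \<in> J' \<rightarrow>\<^sub>E B'" "y \<in> J' \<rightarrow>\<^sub>E B'" "\<forall>k\<in>g ` input_window J B f i. x k = y k" for x y
    proof -
      have "\<forall>j\<in>input_window J B f i. p x j = p y j" using that(3) by (simp add: p_def)
      then show ?thesis by (intro determinesD[OF d p[OF that(1)] p[OF that(2)]]) simp
    qed
    show "determines J' B' f' i (g ` input_window J B f i)"
      unfolding determines_def f'_def
    proof (intro conjI ballI impI)
      show "g ` input_window J B f i \<subseteq> J'"
        unfolding J'_def using determines_subset[OF d] by (rule image_mono)
    qed (rule det)
  qed
  have sub: "communication_complex I J' B' f' \<subseteq> communication_complex I J B f"
  proof
    fix S assume "S \<in> communication_complex I J' B' f'"
    then obtain k where "S \<subseteq> I" "k \<in> J'" and k: "\<And>i. i \<in> S \<Longrightarrow> k \<in> input_window J' B' f' i"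
      by (auto simp: communication_complex_def)
    then obtain j where j: "j \<in> J" "k = g j" by (auto simp: J'_def)
    have "j \<in> input_window J B f i" if i: "i \<in> S" for i
    proof -
      obtain j' where j': "j' \<in> input_window J B f i" "g j = g j'"
        using k[OF i] window j by blast
      moreover have "j' \<in> J"
        using determines_subset[OF is_least_input_window(1)[OF J, of B f i]] j'(1) by blast
      ultimately show ?thesis using g j by (metis inj_onD)
    qed
    then show "S \<in> communication_complex I J B f"
      using \<open>S \<subseteq> I\<close> j by (auto simp: communication_complex_def)
  qed
  show ?thesis
    unfolding generates_def
  proof (rule exI[of _ B'], rule exI[of _ J'], rule exI[of _ f'], intro conjI)
    show "communication_complex I J' B' f' \<subseteq> K" using sub K by (rule subset_trans)
  qed (fact fin map img)+
qed

end

theory Submission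
  imports Defs
begin

text \<open>Suppose a maximal simplex \<open>S\<close> of \<open>K\<close> meets \<open>X\<close> and \<open>Y\<close> but not \<open>X \<inter> Y\<close>, and let \<open>f\<close> be a
  map generating \<open>L\<close>. By maximality, the inputs read by all of \<open>S\<close> are read by no output outside
  \<open>S\<close>. Give each of them a second copy, read by the outputs in \<open>Y\<close>, while those in \<open>X\<close> keep
  reading the original. The restrictions to \<open>X\<close> and to \<open>Y\<close> of an output of the new map are
  restrictions of outputs of \<open>f\<close>, so the new image stays inside \<open>L\<close> because \<open>X\<close> and \<open>Y\<close> decompose
  \<open>L\<close>; equal copies recover all of \<open>L\<close>. The simplex \<open>S\<close> has been replaced by \<open>S \<inter> X\<close> and
  \<open>S \<inter> Y\<close>, contradicting minimality.\<close>

lemma simplicial_complex_on_remove_maximal: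
  assumes "simplicial_complex_on I K" "maximal_simplex K S"
  shows "simplicial_complex_on I (K - {S})"
  using assms unfolding simplicial_complex_on_def maximal_simplex_def by blast

lemma generates_remove_split_simplex:
  assumes L: "L \<subseteq> I \<rightarrow>\<^sub>E A" and XY: "X \<union> Y = I" and dec: "decompose A I X Y L"
    and K: "simplicial_complex_on I K" and gen: "generates A I K L" and S: "maximal_simplex K S"
    and SX: "S \<inter> X \<noteq> {}" and SY: "S \<inter> Y \<noteq> {}" and SXY: "S \<inter> (X \<inter> Y) = {}"
  shows "generates A I (K - {S}) L"
proof -
  obtain B J :: "nat set" and f where B: "finite B" and J: "finite J"
    and f: "f \<in> (J \<rightarrow>\<^sub>E B) \<rightarrow> (I \<rightarrow>\<^sub>E A)" and img: "f ` (J \<rightarrow>\<^sub>E B) = L"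
    and sub: "communication_complex I J B f \<subseteq> K"
    using gen unfolding generates_def by blast
  have SI: "S \<subseteq> I"
    using K S unfolding simplicial_complex_on_def maximal_simplex_def by blast
  define W where "W = input_window J B f"
  have det: "determines J B f i (W i)" for i
    unfolding W_def by (rule is_least_input_window(1)[OF J])
  have WJ: "W i \<subseteq> J" for i using det by (rule determines_subset)
  have simplex: "T \<in> K" if "T \<subseteq> I" "j \<in> J" "\<And>i. i \<in> T \<Longrightarrow> j \<in> W i" for T j
    using that sub unfolding communication_complex_def W_def by blast
  \<comment> \<open>\<open>D\<close> is empty if \<open>S\<close> is a simplex of \<open>K\<close>
    but not of the communication complex of \<open>f\<close>; then \<open>p\<close> and
    \<open>q\<close> below coincide and no input is split.\<close>
  define D where "D = {j \<in> J. \<forall>i\<in>S. j \<in> W i}"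
  have D_reader: "i \<in> S" if "j \<in> D" "i \<in> I" "j \<in> W i" for i j
  proof -
    have "insert i S \<in> K"
      using that SI by (intro simplex[where j = j]) (auto simp: D_def)
    then show ?thesis using S unfolding maximal_simplex_def by blast
  qed
  \<comment> \<open>\<open>Inl j\<close> is the original input and \<open>Inr j\<close> the second
    copy of a \<open>j\<close> in \<open>D\<close>. Here \<open>p\<close> reads only originals,
    while \<open>q\<close> reads the second copy wherever there is one.\<close>
  define J' where "J' = J <+> D"
  define p where "p x = (\<lambda>j\<in>J. x (Inl j))" for x :: "nat + nat \<Rightarrow> nat"
  define q where "q x = (\<lambda>j\<in>J. if j \<in> D then x (Inr j) else x (Inl j))" for x :: "nat + nat \<Rightarrow> nat"
  define f' where "f' x = (\<lambda>i\<in>I. if i \<in> X then f (p x) i else f (q x) i)" for x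
  have p: "p x \<in> J \<rightarrow>\<^sub>E B" and q: "q x \<in> J \<rightarrow>\<^sub>E B" if "x \<in> J' \<rightarrow>\<^sub>E B" for x
    by (auto simp: p_def q_def J'_def intro!: PiE_mem[OF that])
  have f'_X: "f' x i = f (p x) i" if "i \<in> X" for x i
    using that XY by (auto simp: f'_def)
  have f'_Y: "f' x i = f (q x) i" if x: "x \<in> J' \<rightarrow>\<^sub>E B" and i: "i \<in> Y" for x i
  proof (cases "i \<in> X")
    case True
    have "f (p x) i = f (q x) i"
    proof (rule determinesD[OF det p[OF x] q[OF x]])
      \<comment> \<open>\<open>p x\<close> and \<open>q x\<close> differ only on \<open>D\<close>.
        An output in \<open>X \<inter> Y\<close> reads no input of \<open>D\<close>, since by
        \<open>D_reader\<close> it would lie in \<open>S\<close>, against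
        \<open>SXY\<close>.\<close>
      show "p x j = q x j" if "j \<in> W i" for j
        using D_reader[of j i] that True i XY SXY by (auto simp: p_def q_def)
    qed
    then show ?thesis using True f'_X by metis
  qed (use i XY in \<open>auto simp: f'_def\<close>)
  have fA: "f y \<in> I \<rightarrow>\<^sub>E A" if "y \<in> J \<rightarrow>\<^sub>E B" for y using f that by blast
  have f'_A: "f' x \<in> I \<rightarrow>\<^sub>E A" if "x \<in> J' \<rightarrow>\<^sub>E B" for x
    using PiE_mem[OF fA[OF p[OF that]]] PiE_mem[OF fA[OF q[OF that]]] by (auto simp: f'_def)
  have f'_L: "f' x \<in> L" if x: "x \<in> J' \<rightarrow>\<^sub>E B" for x
  proof -
    have "f (p x) \<in> L" "f (q x) \<in> L" using img p[OF x] q[OF x] by blast+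
    moreover have "restrict (f (p x)) X = restrict (f' x) X"
      by (rule restrict_ext) (simp add: f'_X)
    moreover have "restrict (f (q x)) Y = restrict (f' x) Y"
      by (rule restrict_ext) (simp add: f'_Y[OF x])
    ultimately show ?thesis using dec f'_A[OF x] unfolding decompose_def by blast
  qed
  have L_f': "L \<subseteq> f' ` (J' \<rightarrow>\<^sub>E B)"
  proof
    fix w assume "w \<in> L"
    then obtain y where y: "y \<in> J \<rightarrow>\<^sub>E B" "f y = w" using img by blast
    \<comment> \<open>Both copies of each input carry the value given by \<open>y\<close>, so
      \<open>p\<close> and \<open>q\<close> both return \<open>y\<close>.\<close>
    define x where "x = (\<lambda>k\<in>J'. case_sum y y k)"
    have x: "x \<in> J' \<rightarrow>\<^sub>E B"
      using PiE_mem[OF y(1)] by (auto simp: x_def J'_def D_def)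
    have "p x = y" "q x = y"
      using PiE_arb[OF y(1)] by (auto simp: p_def q_def x_def J'_def fun_eq_iff)
    then have "f' x = w"
      using PiE_arb[OF fA[OF y(1)]] y(2) by (intro ext) (auto simp: f'_def)
    then show "w \<in> f' ` (J' \<rightarrow>\<^sub>E B)" using x by blast
  qed
  \<comment> \<open>Only an upper bound for the windows of \<open>f'\<close> is required: smaller
    windows give fewer simplices.\<close>
  define W' where "W' i = (if i \<in> X then Inl ` W i else Inl ` (W i - D) \<union> Inr ` (W i \<inter> D))" for i
  have J': "finite J'" using J by (simp add: J'_def D_def)
  have window: "input_window J' B f' i \<subseteq> W' i" if i: "i \<in> I" for i
  proof (rule is_least_input_window(2)[OF J'])
    have "f' x i = f' y i"
      if x: "x \<in> J' \<rightarrow>\<^sub>E B" and y: "y \<in> J' \<rightarrow>\<^sub>E B" and xy: "\<forall>k\<in>W' i. x k = y k" for x y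
    proof (cases "i \<in> X")
      case True
      then have "f (p x) i = f (p y) i"
        using xy by (intro determinesD[OF det p[OF x] p[OF y]]) (auto simp: W'_def p_def)
      then show ?thesis using True by (simp add: f'_X)
    next
      case False
      then have "f (q x) i = f (q y) i"
        using xy by (intro determinesD[OF det q[OF x] q[OF y]]) (auto simp: W'_def q_def)
      then show ?thesis using False i by (simp add: f'_def)
    qed
    moreover have "W' i \<subseteq> J'" using WJ[of i] by (auto simp: W'_def J'_def)
    ultimately show "determines J' B f' i (W' i)" unfolding determines_def by blast
  qed
  have "communication_complex I J' B f' \<subseteq> K - {S}"
  proof
    fix T assume "T \<in> communication_complex I J' B f'"
    then obtain k where T: "T \<subseteq> I" and k: "k \<in> J'" and kT: "\<And>i. i \<in> T \<Longrightarrow> k \<in> W' i"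
      unfolding communication_complex_def using window by blast
    show "T \<in> K - {S}"
    proof (cases k)
      case (Inl j)
      have j: "j \<in> J" using k Inl by (auto simp: J'_def)
      have jT: "j \<in> W i \<and> (i \<in> X \<or> j \<notin> D)" if "i \<in> T" for i
        using kT[OF that] Inl by (auto simp: W'_def split: if_splits)
      have "T \<in> K" using T j jT by (blast intro: simplex)
      moreover have "T \<noteq> S"
      proof
        assume "T = S"
        then have "j \<in> D" using j jT by (auto simp: D_def)
        \<comment> \<open>\<open>S\<close> has an element in \<open>Y\<close>, hence outside
          \<open>X\<close>, and such an output does not read the original of an input in
          \<open>D\<close>.\<close>
        then show False using jT \<open>T = S\<close> SY SXY by blast
      qed
      ultimately show ?thesis by blast
    next
      case (Inr j)
      have j: "j \<in> J" using k Inr by (auto simp: J'_def D_def)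
      have jT: "j \<in> W i \<and> i \<notin> X" if "i \<in> T" for i
        using kT[OF that] Inr by (auto simp: W'_def split: if_splits)
      have "T \<in> K" using T j jT by (blast intro: simplex)
      \<comment> \<open>Second copies are read only outside \<open>X\<close>, whereas
        \<open>S\<close> meets \<open>X\<close>.\<close>
      moreover have "T \<noteq> S" using jT SX by blast
      ultimately show ?thesis by blast
    qed
  qed
  then show ?thesis
    \<comment> \<open>The inputs are now indexed in \<open>nat + nat\<close>;
      \<open>generatesI\<close> recodes them by natural numbers.\<close>
    using f'_A f'_L L_f' by (intro generatesI[OF B J', of f']) auto
qed

theorem theorem4p2:
  fixes A :: "'a set" and I :: "'i set" and L :: "('i \<Rightarrow> 'a) set"
    and X Y :: "'i set" and K :: "'i set set"
  assumes "finite A" and "finite I"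
    and "L \<subseteq> I \<rightarrow>\<^sub>E A"
    and "X \<subseteq> I" and "Y \<subseteq> I" and "X \<union> Y = I"
    and "decompose A I X Y L"
    and "minimal_generating A I K L"
  shows "\<forall>S. maximal_simplex K S \<and> S \<inter> X \<noteq> {} \<and> S \<inter> Y \<noteq> {} \<longrightarrow> S \<inter> (X \<inter> Y) \<noteq> {}"
proof (intro allI impI notI)
  fix S assume S: "maximal_simplex K S \<and> S \<inter> X \<noteq> {} \<and> S \<inter> Y \<noteq> {}" and SXY: "S \<inter> (X \<inter> Y) = {}"
  have K: "simplicial_complex_on I K" and gen: "generates A I K L"
    and min: "\<And>K'. simplicial_complex_on I K' \<Longrightarrow> K' \<subset> K \<Longrightarrow> \<not> generates A I K' L"
    using assms(8) unfolding minimal_generating_def by blast+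
  have "generates A I (K - {S}) L"
    using generates_remove_split_simplex[OF assms(3,6,7) K gen] S SXY by blast
  moreover have "K - {S} \<subset> K" using S unfolding maximal_simplex_def by blast
  ultimately show False
    using min simplicial_complex_on_remove_maximal[OF K] S by blast
qed

end
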